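(* Let $q=2^m$ with $m$ a positive integer, let $f\in\mathbb{F}_q[x]$ be an o-polynomial, let $v\in\mathbb{F}_q\setminus\{f(x)+x : x\in\mathbb{F}_q\}$, and write $\mathbb{F}_q=\{\alpha_1,\ldots,\alpha_{q-1},\alpha_q\}$ with $\alpha_q=0$. Let $\mathcal{C}_v$ be the $[q+5,3,q+2]$ NMDS code over $\mathbb{F}_q$ with generator matrix $$G_v=\begin{pmatrix} f(\alpha_1) & f(\alpha_2) & \cdots & f(\alpha_{q-1}) & f(\alpha_q) & 1 & 0 & 1 & 0 & v\\ \alpha_1 & \alpha_2 & \cdots & \alpha_{q-1} & \alpha_q & 0 & 1 & 1 & v & 0\\ 1 & 1 & \cdots & 1 & 1 & 0 & 0 & 0 & 1 & 1\end{pmatrix}.$$ Then $\mathcal{C}_v$ has locality $2$, and its dual code $\mathcal{C}_v^{\perp}$ has locality $q+1$.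
   Context: An $[n,k,d]$ linear code over $\mathbb{F}_q$ is a $k$-dimensional subspace $\mathcal{C}$ of $\mathbb{F}_q^n$ with minimum nonzero Hamming weight $d$. Its dual $\mathcal{C}^\perp$ is taken with respect to the Euclidean inner product. The Singleton defect of an $[n,k,d]$ code is $s(\mathcal{C})=n-k+1-d$; $\mathcal{C}$ is near maximum distance separable (NMDS) if $s(\mathcal{C})=s(\mathcal{C}^\perp)=1$. For $q$ a power of $2$, an o-polynomial (oval polynomial) over $\mathbb{F}_q$ is a permutation polynomial $f\in\mathbb{F}_q[x]$ of $\mathbb{F}_q$ such that (1) $\deg f<q$, $f(0)=0$, $f(1)=1$; and (2) for each $a\in\mathbb{F}_q$, $g_a(x):=(f(x+a)+f(a))x^{q-2}$ is also a permutation polynomial of $\mathbb{F}_q$. A code $\mathcal{C}$ of length $n$ has locality $r$ if for every $i\in[n]=\{1,\ldots,n\}$ there exist a subset $R_i\subseteq[n]\setminus\{i\}$ with $\#R_i\le r$ and a function $\phi_i$ such that $c_i=\phi_i(\{c_j : j\in R_i\})$ for every codeword $(c_1,\ldots,c_n)\in\mathcal{C}$. *)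

theory Defs
  imports
    "HOL-Library.FuncSet"
    "HOL-Library.Cardinality"
    "HOL-Computational_Algebra.Polynomial"
    "Jordan_Normal_Form.VS_Connect"
begin

definition hamming_weight :: "'a::zero vec \<Rightarrow> nat" where
  "hamming_weight c = card {i. i < dim_vec c \<and> c $ i \<noteq> 0}"

text \<open>
  The last three conjuncts say that \<open>d\<close> is the minimum weight of a nonzero codeword; in
  particular the zero code has no parameters \<open>[n, k, d]\<close>.
\<close>

definition linear_code :: "nat \<Rightarrow> nat \<Rightarrow> nat \<Rightarrow> 'a::field vec set \<Rightarrow> bool" where
  "linear_code n k d C \<longleftrightarrow>
     subspace class_ring C (module_vec TYPE('a) n) \<and>
     vectorspace.dim class_ring ((module_vec TYPE('a) n)\<lparr>carrier := C\<rparr>) = k \<and>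
     (\<exists>c\<in>C. c \<noteq> 0\<^sub>v n \<and> hamming_weight c = d) \<and>
     (\<forall>c\<in>C. c \<noteq> 0\<^sub>v n \<longrightarrow> d \<le> hamming_weight c)"

definition dual_code :: "nat \<Rightarrow> 'a::field vec set \<Rightarrow> 'a vec set" where
  "dual_code n C = {x \<in> carrier_vec n. \<forall>c\<in>C. c \<bullet> x = 0}"

definition singleton_defect :: "nat \<Rightarrow> nat \<Rightarrow> nat \<Rightarrow> int" where
  "singleton_defect n k d = int n - int k + 1 - int d"

definition nmds :: "nat \<Rightarrow> 'a::field vec set \<Rightarrow> bool" where
  "nmds n C \<longleftrightarrow>
     (\<exists>k d. linear_code n k d C \<and> singleton_defect n k d = 1) \<and>
     (\<exists>k d. linear_code n k d (dual_code n C) \<and> singleton_defect n k d = 1)"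

text \<open>
  Coordinates are numbered \<open>0, \<dots>, n - 1\<close>. The repair function \<open>\<phi>\<close> receives the
  indexed family \<open>(c\<^sub>j)\<close> for \<open>j \<in> R\<close>, encoded as a function that is \<open>undefined\<close> outside \<open>R\<close>.
\<close>

definition has_locality :: "nat \<Rightarrow> 'a vec set \<Rightarrow> nat \<Rightarrow> bool" where
  "has_locality n C r \<longleftrightarrow>
     (\<forall>i<n. \<exists>R \<subseteq> {..<n} - {i}. card R \<le> r \<and>
        (\<exists>\<phi> :: (nat \<Rightarrow> 'a) \<Rightarrow> 'a. \<forall>c\<in>C. c $ i = \<phi> (restrict (\<lambda>j. c $ j) R)))"

definition permutation_poly :: "'a::field poly \<Rightarrow> bool" where
  "permutation_poly f \<longleftrightarrow> bij (poly f)"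

text \<open>The product below is the polynomial \<open>g\<^sub>a(x) = (f(x + a) + f(a)) x\<^bsup>q - 2\<^esup>\<close>.\<close>

definition o_polynomial :: "'a::{field,finite} poly \<Rightarrow> bool" where
  "o_polynomial f \<longleftrightarrow>
     permutation_poly f \<and> degree f < CARD('a) \<and> poly f 0 = 0 \<and> poly f 1 = 1 \<and>
     (\<forall>a. permutation_poly
        ((pcompose f [:a, 1:] + [:poly f a:]) * monom 1 (CARD('a) - 2)))"

definition gen_matrix :: "'a::{field,finite} poly \<Rightarrow> (nat \<Rightarrow> 'a) \<Rightarrow> 'a \<Rightarrow> 'a mat" where
  "gen_matrix f \<alpha> v = mat_of_rows_list (CARD('a) + 5)
     [map (\<lambda>j. poly f (\<alpha> j)) [1..<CARD('a) + 1] @ [1, 0, 1, 0, v],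
      map \<alpha> [1..<CARD('a) + 1]                 @ [0, 1, 1, v, 0],
      map (\<lambda>j. 1) [1..<CARD('a) + 1]           @ [0, 0, 0, 1, 1]]"

definition code_of :: "'a::field mat \<Rightarrow> 'a vec set" where
  "code_of G = vec_space.row_space (dim_col G) G"

end

theory Submission
  imports Defs "Jordan_Normal_Form.Matrix_Kernel"
begin

text \<open>The columns of \<open>G\<^sub>v\<close> are points of the projective plane of order \<open>q\<close>. As \<open>f\<close> is an o-polynomial,
  the slopes of its graph at a fixed point are pairwise different, so the first \<open>q + 2\<close> columns form
  a hyperoval, which every line meets in at most two points. The last three columns lie on the line
  \<open>x + y = v z\<close>, which misses the hyperoval by the choice of \<open>v\<close>. Hence a line contains at most three
  columns, which gives the minimum distance \<open>q + 2\<close>.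

  Every column lies on a line with two others: a point of the hyperoval is joined to
  \<open>(1, 1, 0)\<close> by a line that meets the hyperoval once more. These triples are dual words of weight \<open>3\<close>
  and give locality \<open>2\<close>. Conversely, the lines \<open>x + y = v z\<close>, \<open>z = 0\<close> and \<open>x = 0\<close> contain exactly three
  columns each and have no column in common, so every coordinate is in the support of a codeword
  of weight \<open>q + 2\<close>; this gives the locality \<open>q + 1\<close> of the dual.\<close>

section \<open>Matrices as linear maps: row space, kernel and dimensions\<close>

text \<open>Makes rank-nullity for abstract linear maps available for a matrix and for its
  transpose.\<close>

lemma linear_map_mult_mat_vec:
  fixes A :: "'a::field mat"
  assumes "A \<in> carrier_mat nr nc"
  shows "linear_map class_ring (module_vec TYPE('a) nc) (module_vec TYPE('a) nr) ((*\<^sub>v) A)"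
proof -
  interpret V: vec_space "TYPE('a)" nc .
  interpret W: vec_space "TYPE('a)" nr .
  show ?thesis
  proof (intro linear_map.intro mod_hom.intro mod_hom_axioms.intro)
    show "vectorspace class_ring V.V" "vectorspace class_ring W.V"
      by (rule vec_vs)+
    show "Module.module class_ring V.V" "Module.module class_ring W.V"
      by (rule vec_module)+
    show "(*\<^sub>v) A \<in> LinearCombinations.module_hom class_ring V.V W.V"
      using assms mult_add_distrib_mat_vec[OF assms] mult_mat_vec[OF assms]
      by (auto simp: LinearCombinations.module_hom_def)
  qed
qed

lemma code_of_eq_range:
  fixes A :: "'a::field mat"
  assumes "A \<in> carrier_mat nr nc"
  shows "code_of A = (*\<^sub>v) A\<^sup>T ` carrier_vec nr"
  using vec_space.row_space_eq[OF assms] assms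
  by (auto simp: code_of_def)

text \<open>The transpose moves across the inner product, so orthogonality to the code says that
  \<open>A *\<^sub>v x\<close> is orthogonal to every vector; unit vectors then make it
  zero.\<close>

lemma dual_code_of_eq_kernel:
  fixes A :: "'a::field mat"
  assumes A: "A \<in> carrier_mat nr nc"
  shows "dual_code nc (code_of A) = mat_kernel A"
proof -
  have "A *\<^sub>v x = 0\<^sub>v nr \<longleftrightarrow> (\<forall>y\<in>carrier_vec nr. (A\<^sup>T *\<^sub>v y) \<bullet> x = 0)"
    if x: "x \<in> carrier_vec nc" for x
  proof
    assume r: "\<forall>y\<in>carrier_vec nr. (A\<^sup>T *\<^sub>v y) \<bullet> x = 0"
    show "A *\<^sub>v x = 0\<^sub>v nr"
    proof (rule eq_vecI)
      fix i assume i: "i < dim_vec (0\<^sub>v nr :: 'a vec)"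
      have "unit_vec nr i \<bullet> (A *\<^sub>v x) = 0"
        using r transpose_vec_mult_scalar[OF A x, of "unit_vec nr i"] by simp
      then show "(A *\<^sub>v x) $ i = 0\<^sub>v nr $ i"
        using i A x by (simp add: scalar_prod_left_unit)
    qed (use A in auto)
  qed (use transpose_vec_mult_scalar[OF A x] in auto)
  then show ?thesis
    unfolding dual_code_def code_of_eq_range[OF A] mat_kernel[OF A] by auto
qed

text \<open>A vector killed by the transpose is orthogonal to the image of \<open>A\<close>, which
  is everything. So the transpose is injective and its image, the code, has dimension
  \<open>nr\<close>.\<close>

lemma code_of_subspace_dim:
  fixes A :: "'a::field mat"
  assumes A: "A \<in> carrier_mat nr nc"
    and surj: "(*\<^sub>v) A ` carrier_vec nc = carrier_vec nr"
  shows "subspace class_ring (code_of A) (module_vec TYPE('a) nc)"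
    and "vectorspace.dim class_ring ((module_vec TYPE('a) nc)\<lparr>carrier := code_of A\<rparr>) = nr"
proof -
  have At: "A\<^sup>T \<in> carrier_mat nc nr" using A by simp
  interpret V: vec_space "TYPE('a)" nr .
  interpret W: vec_space "TYPE('a)" nc .
  interpret T: linear_map class_ring V.V W.V "(*\<^sub>v) A\<^sup>T"
    by (rule linear_map_mult_mat_vec[OF At])
  have im: "T.imT = code_of A"
    using code_of_eq_range[OF A] by (simp add: T.im_def)
  show "subspace class_ring (code_of A) W.V"
    using T.imT_is_subspace im by simp
  have zero: "y = 0\<^sub>v nr" if y: "y \<in> carrier_vec nr" "A\<^sup>T *\<^sub>v y = 0\<^sub>v nc" for y
  proof (rule eq_vecI)
    fix i assume i: "i < dim_vec (0\<^sub>v nr :: 'a vec)"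
    then obtain x where x: "x \<in> carrier_vec nc" "A *\<^sub>v x = unit_vec nr i"
      using surj by (metis image_iff unit_vec_carrier)
    have "y \<bullet> unit_vec nr i = 0"
      using transpose_vec_mult_scalar[OF A x(1) y(1)] x y(2) by simp
    then show "y $ i = 0\<^sub>v nr $ i"
      using i y(1) by (simp add: scalar_prod_right_unit)
  qed (use y in auto)
  have "T.kerT = {0\<^sub>v nr}"
    using zero At by (auto simp: T.ker_def)
  then have "inj_on ((*\<^sub>v) A\<^sup>T) (carrier V.V)"
    using T.Ke0_imp_inj by simp
  from T.inj_imp_dim_ker0[OF this] T.rank_nullity
  show "vectorspace.dim class_ring (W.V\<lparr>carrier := code_of A\<rparr>) = nr"
    by (simp add: im V.dim_is_n)
qed

lemma dual_code_of_subspace_dim: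
  fixes A :: "'a::field mat"
  assumes A: "A \<in> carrier_mat nr nc"
    and surj: "(*\<^sub>v) A ` carrier_vec nc = carrier_vec nr"
  shows "subspace class_ring (dual_code nc (code_of A)) (module_vec TYPE('a) nc)"
    and "vectorspace.dim class_ring
      ((module_vec TYPE('a) nc)\<lparr>carrier := dual_code nc (code_of A)\<rparr>) = nc - nr"
proof -
  interpret V: vec_space "TYPE('a)" nc .
  interpret W: vec_space "TYPE('a)" nr .
  interpret T: linear_map class_ring V.V W.V "(*\<^sub>v) A"
    by (rule linear_map_mult_mat_vec[OF A])
  have ker: "T.kerT = dual_code nc (code_of A)"
    unfolding dual_code_of_eq_kernel[OF A] mat_kernel[OF A] T.ker_def by simp
  show "subspace class_ring (dual_code nc (code_of A)) V.V"
    using T.kerT_is_subspace ker by simp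
  have "T.imT = carrier_vec nr"
    using surj by (simp add: T.im_def)
  then have "W.V\<lparr>carrier := T.imT\<rparr> = W.V"
    by (simp only:) (simp add: module_vec_def)
  then have "vectorspace.dim class_ring (W.V\<lparr>carrier := T.imT\<rparr>) = nr"
    using W.dim_is_n by simp
  then show "vectorspace.dim class_ring (V.V\<lparr>carrier := dual_code nc (code_of A)\<rparr>) = nc - nr"
    using T.rank_nullity by (simp add: ker V.dim_is_n)
qed

section \<open>Hamming weight and locality\<close>

lemma hamming_weight_add_card_zeros:
  "hamming_weight c + card {i. i < dim_vec c \<and> c $ i = 0} = dim_vec c"
proof -
  have "card ({i. i < dim_vec c \<and> c $ i \<noteq> 0} \<union> {i. i < dim_vec c \<and> c $ i = 0})
    = hamming_weight c + card {i. i < dim_vec c \<and> c $ i = 0}"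
    unfolding hamming_weight_def by (rule card_Un_disjoint) auto
  moreover have "{i. i < dim_vec c \<and> c $ i \<noteq> 0} \<union> {i. i < dim_vec c \<and> c $ i = 0}
    = {..<dim_vec c}" by auto
  ultimately show ?thesis by simp
qed

text \<open>An orthogonal word with \<open>i\<close> in its support expresses the \<open>i\<close>-th coordinate
  through the rest of that support.\<close>

lemma has_locality_if_orthogonal:
  fixes C :: "'a::field vec set"
  assumes C: "C \<subseteq> carrier_vec n"
    and w: "\<And>i. i < n \<Longrightarrow> \<exists>y\<in>carrier_vec n. y $ i \<noteq> 0 \<and> hamming_weight y \<le> r + 1 \<and> (\<forall>c\<in>C. y \<bullet> c = 0)"
  shows "has_locality n C r"
  unfolding has_locality_def
proof (intro allI impI)
  fix i assume i: "i < n"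
  from w[OF i] obtain y where y: "y \<in> carrier_vec n" "y $ i \<noteq> 0" "hamming_weight y \<le> r + 1"
    and orth: "\<And>c. c \<in> C \<Longrightarrow> y \<bullet> c = 0"
    by blast
  define S where "S = {j. j < dim_vec y \<and> y $ j \<noteq> 0}"
  define R where "R = S - {i}"
  \<comment> \<open>Solves the orthogonality relation for coordinate \<open>i\<close>; it reads
    \<open>g\<close> only on \<open>R\<close>, where \<open>restrict\<close> changes
    nothing.\<close>
  define \<phi> where "\<phi> g = - (\<Sum>j\<in>R. y $ j * g j) / y $ i" for g
  have S: "finite S" "S \<subseteq> {..<n}" "i \<in> S" "card S \<le> r + 1"
    using y i by (auto simp: S_def hamming_weight_def)
  have "c $ i = \<phi> (restrict (($) c) R)" if c: "c \<in> C" for c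
  proof -
    have cn: "c \<in> carrier_vec n" using c C by auto
    have "0 = (\<Sum>j\<in>{..<n}. y $ j * c $ j)"
      using orth[OF c] cn by (simp add: scalar_prod_def atLeast0LessThan)
    also have "\<dots> = (\<Sum>j\<in>S. y $ j * c $ j)"
      using S y(1) by (intro sum.mono_neutral_right) (auto simp: S_def)
    also have "\<dots> = y $ i * c $ i + (\<Sum>j\<in>R. y $ j * c $ j)"
      unfolding R_def using S by (simp add: sum.remove)
    finally show ?thesis
      using y(2) by (simp add: \<phi>_def field_simps eq_neg_iff_add_eq_0)
  qed
  moreover have "R \<subseteq> {..<n} - {i}" "card R \<le> r"
    using S by (auto simp: R_def)
  ultimately show "\<exists>R \<subseteq> {..<n} - {i}. card R \<le> r \<and>
      (\<exists>\<phi>. \<forall>c\<in>C. c $ i = \<phi> (restrict (\<lambda>j. c $ j) R))"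
    by blast
qed

section \<open>Finite fields of even order\<close>

text \<open>Multiplication by \<open>x\<close> permutes the nonzero elements, so their product is
  unchanged by the factor \<open>x ^ (CARD('a) - 1)\<close>.\<close>

lemma power_CARD_minus_1_eq_1:
  fixes x :: "'a::{field,finite}"
  assumes "x \<noteq> 0"
  shows "x ^ (CARD('a) - 1) = 1"
proof -
  have "(\<Prod>y\<in>UNIV - {0}. x * y) = (\<Prod>y\<in>UNIV - {0}. y)"
    by (rule prod.reindex_bij_witness[of _ "\<lambda>y. y / x" "\<lambda>y. x * y"]) (use assms in auto)
  then show ?thesis
    by (simp add: prod.distrib card_Diff_singleton)
qed

text \<open>An odd power of -1 equals 1 by the previous lemma, hence -1 = 1.\<close>

lemma add_self_eq_0_if_even_CARD:
  fixes x :: "'a::{field,finite}"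
  assumes "even CARD('a)"
  shows "x + x = 0"
proof -
  have "odd (CARD('a) - 1)"
    using assms zero_less_card_finite[where 'a = 'a] by simp
  then have "- 1 = (1 :: 'a)"
    using power_CARD_minus_1_eq_1[of "- 1 :: 'a"] by simp
  then have "- x = x"
    by (metis mult_minus1 mult_1)
  then show ?thesis by (metis add.right_inverse)
qed

lemma o_polynomial_slope_bij:
  fixes f :: "'a::{field,finite} poly"
  assumes "o_polynomial f"
  shows "bij (\<lambda>z. (poly f (a + z) + poly f a) * z ^ (CARD('a) - 2))"
proof -
  have "poly ((pcompose f [:a, 1:] + [:poly f a:]) * monom 1 (CARD('a) - 2))
    = (\<lambda>z. (poly f (a + z) + poly f a) * z ^ (CARD('a) - 2))"
    by (simp add: fun_eq_iff poly_pcompose poly_monom)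
  moreover have "bij (poly ((pcompose f [:a, 1:] + [:poly f a:]) * monom 1 (CARD('a) - 2)))"
    using assms unfolding o_polynomial_def permutation_poly_def by blast
  ultimately show ?thesis by simp
qed

lemma line_difference:
  fixes a b c x y x' y' :: "'a::comm_ring"
  assumes "a * y + b * x + c = a * y' + b * x' + c"
  shows "a * (y - y') = b * (x' - x)"
  using assms by (simp add: algebra_simps)

lemma less_3_cases:
  assumes "i < (3 :: nat)"
  obtains "i = 0" | "i = Suc 0" | "i = 2"
  using assms by linarith

section \<open>Characteristic two and slopes of the graph of \<open>f\<close>\<close>

locale oval_code =
  fixes f :: "'a::{field,finite} poly" and v :: 'a and \<alpha> :: "nat \<Rightarrow> 'a" and q :: nat
  assumes q_card: "CARD('a) = q"
    and q_even: "even q"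
    and opoly: "o_polynomial f"
    and v_not: "v \<noteq> poly f x + x"
    and \<alpha>_bij: "bij_betw \<alpha> {1..q} UNIV"
    and \<alpha>_q: "\<alpha> q = 0"
begin

lemma q_ge_2: "q \<ge> 2"
  using q_even q_card zero_less_card_finite[where 'a = 'a] by auto

lemma add_self [simp]: "x + x = (0 :: 'a)"
  using add_self_eq_0_if_even_CARD q_even q_card by blast

lemma two_eq_0 [simp]: "2 = (0 :: 'a)"
  by (metis add_self one_add_one)

lemma minus_eq [simp]: "- x = (x :: 'a)" and diff_eq: "x - y = (x + y :: 'a)"
proof -
  show *: "- x = x" for x :: 'a
    by (metis add_eq_0_iff add_self)
  show "x - y = x + y"
    by (metis * diff_conv_add_uminus)
qed

lemma add_eq_0 [simp]: "x + y = 0 \<longleftrightarrow> x = (y :: 'a)"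
  by (metis eq_iff_diff_eq_0 diff_eq)

lemma f_0 [simp]: "poly f 0 = 0"
  using opoly by (simp add: o_polynomial_def)

lemma f_inj: "inj (poly f)"
  using opoly by (simp add: o_polynomial_def permutation_poly_def bij_is_inj)

lemma f_eq_0 [simp]: "poly f x = 0 \<longleftrightarrow> x = 0"
  using f_inj by (metis f_0 injD)

lemma v_nz [simp]: "v \<noteq> 0"
  using v_not[of 0] by simp

text \<open>The power \<open>z ^ (q - 2)\<close> is the inverse of a nonzero \<open>z\<close>, so
  the o-polynomial condition speaks about slopes of secants of the graph.\<close>

lemma slope_eq:
  assumes "z \<noteq> 0"
  shows "(poly f (a + z) + poly f a) * z ^ (q - 2) = (poly f (a + z) + poly f a) / z"
proof -
  have "Suc (q - 2) = q - 1"
    using q_ge_2 by simp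
  then have "z * z ^ (q - 2) = 1"
    using power_CARD_minus_1_eq_1[OF assms] q_card by (metis power_Suc)
  then have "z ^ (q - 2) = 1 / z"
    using assms by (simp add: field_simps)
  then show ?thesis by simp
qed

lemma slope_inj:
  assumes "y \<noteq> x" "z \<noteq> x"
    and "(poly f x + poly f y) / (x + y) = (poly f x + poly f z) / (x + z)"
  shows "y = z"
proof -
  let ?g = "\<lambda>z. (poly f (x + z) + poly f x) * z ^ (q - 2)"
  have "inj ?g"
    using o_polynomial_slope_bij[OF opoly, of x] q_card by (simp add: bij_is_inj)
  moreover have g: "?g (x + w) = (poly f x + poly f w) / (x + w)" if "w \<noteq> x" for w
  proof -
    have "x + (x + w) = w" by (simp flip: add.assoc)
    moreover have "x + w \<noteq> 0" using that by (auto simp del: add_self)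
    ultimately show ?thesis
      using slope_eq[of "x + w" x] by (simp only:) (simp add: add.commute)
  qed
  have "?g (x + y) = ?g (x + z)"
    using g[OF assms(1)] g[OF assms(2)] assms(3) by (simp only:)
  ultimately have "x + y = x + z" by (rule injD)
  then show ?thesis by simp
qed

text \<open>The surjective half of the o-polynomial condition. A secant of slope 1 passes through
  (1, 1, 0), which later gives each affine column its partner.\<close>

lemma slope_1_exists:
  obtains y where "y \<noteq> x" "poly f x + poly f y = x + y"
proof -
  have "surj (\<lambda>z. (poly f (x + z) + poly f x) * z ^ (q - 2))"
    using o_polynomial_slope_bij[OF opoly, of x] q_card by (simp add: bij_is_surj)
  from surjE[OF this, of 1] obtain z where z: "(poly f (x + z) + poly f x) * z ^ (q - 2) = 1"
    by metis
  \<comment> \<open>At z = 0 the first factor is f(x) + f(x) = 0, so the product is 0 even for q =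
    2, where the power is 0 ^ 0 = 1.\<close>
  then have "z \<noteq> 0" by (intro notI) simp
  then have "(poly f (x + z) + poly f x) / z = 1"
    using slope_eq z by metis
  with \<open>z \<noteq> 0\<close> have "poly f x + poly f (x + z) = z"
    by (simp add: add.commute)
  moreover have "x + (x + z) = z" by (simp flip: add.assoc)
  ultimately show ?thesis
    using \<open>z \<noteq> 0\<close> by (intro that[of "x + z"]) auto
qed

section \<open>The generator matrix and its codewords\<close>

text \<open>Column \<open>j\<close> of the generator matrix is \<open>(X j, Y j, Z j)\<close>; columns are numbered from \<open>0\<close>, so
  \<open>\<alpha>\<^sub>j\<close> belongs to column \<open>j - 1\<close>.\<close>

definition "X j = (if j < q then poly f (\<alpha> (Suc j)) else if j = q \<or> j = q + 2 then 1
  else if j = q + 4 then v else 0)"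

definition "Y j = (if j < q then \<alpha> (Suc j) else if j = q + 1 \<or> j = q + 2 then 1
  else if j = q + 3 then v else 0)"

definition Z :: "nat \<Rightarrow> 'a" where
  "Z j = (if j < q \<or> j = q + 3 \<or> j = q + 4 then 1 else 0)"

lemmas column_defs = X_def Y_def Z_def

abbreviation G where "G \<equiv> gen_matrix f \<alpha> v"

lemma index_cases:
  assumes "j < q + 5"
  obtains "j < q" | "j = q" | "j = q + 1" | "j = q + 2" | "j = q + 3" | "j = q + 4"
  using assms by linarith

lemma G_carrier [simp]: "G \<in> carrier_mat 3 (q + 5)"
  by (rule carrier_matI) (simp_all add: gen_matrix_def mat_of_rows_list_def q_card)

lemma map_upt_append_nth:
  "(map h [Suc 0..<Suc q] @ ys) ! j = (if j < q then h (Suc j) else ys ! (j - q))"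
  by (simp add: nth_append del: upt_Suc)

lemma G_index:
  assumes "j < q + 5"
  shows "G $$ (0, j) = X j" "G $$ (Suc 0, j) = Y j" "G $$ (2, j) = Z j"
proof -
  have G: "G = mat 3 (q + 5) (\<lambda>(i, j). [map (\<lambda>j. poly f (\<alpha> j)) [1..<q + 1] @ [1, 0, 1, 0, v],
      map \<alpha> [1..<q + 1] @ [0, 1, 1, v, 0], map (\<lambda>j. 1) [1..<q + 1] @ [0, 0, 0, 1, 1]] ! i ! j)"
    unfolding gen_matrix_def mat_of_rows_list_def q_card
    by (simp add: numeral_3_eq_3 del: upt_Suc)
  show "G $$ (0, j) = X j"
    using assms unfolding G
    by (cases rule: index_cases) (simp_all add: map_upt_append_nth X_def del: upt_Suc)
  show "G $$ (Suc 0, j) = Y j"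
    using assms unfolding G
    by (cases rule: index_cases) (simp_all add: map_upt_append_nth Y_def del: upt_Suc)
  show "G $$ (2, j) = Z j"
    using assms unfolding G
    by (cases rule: index_cases) (simp_all add: map_upt_append_nth Z_def del: upt_Suc)
qed

lemma G_mult_vec:
  assumes x: "x \<in> carrier_vec (q + 5)"
  shows "G *\<^sub>v x = vec 3 (\<lambda>i. [(\<Sum>j<q+5. X j * x $ j), (\<Sum>j<q+5. Y j * x $ j), (\<Sum>j<q+5. Z j * x $ j)] ! i)"
    (is "_ = vec 3 ?l")
proof (rule eq_vecI)
  fix i assume "i < dim_vec (vec 3 ?l)"
  then have i: "i < 3" by simp
  have "(G *\<^sub>v x) $ i = (\<Sum>j<q+5. G $$ (i, j) * x $ j)"
    using i x carrier_matD[OF G_carrier]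
    by (simp add: scalar_prod_def atLeast0LessThan)
  also have "\<dots> = ?l i"
    using i by (cases rule: less_3_cases) (simp_all add: G_index)
  finally show "(G *\<^sub>v x) $ i = vec 3 ?l $ i" using i by simp
qed (simp add: carrier_matD[OF G_carrier])

text \<open>A zero at \<open>j\<close> means that column \<open>j\<close> lies on the projective
  line with coordinates (a, b, c).\<close>

definition form :: "'a \<Rightarrow> 'a \<Rightarrow> 'a \<Rightarrow> nat \<Rightarrow> 'a" where
  "form a b c j = a * X j + b * Y j + c * Z j"

abbreviation codeword where "codeword a b c \<equiv> vec (q + 5) (form a b c)"

lemma code_of_G: "code_of G = {codeword a b c | a b c. True}"
proof -
  have eq: "G\<^sup>T *\<^sub>v y = codeword (y $ 0) (y $ 1) (y $ 2)" if y: "y \<in> carrier_vec 3" for y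
  proof (rule eq_vecI)
    fix j assume "j < dim_vec (codeword (y $ 0) (y $ 1) (y $ 2))"
    then have j: "j < q + 5" by simp
    have "(G\<^sup>T *\<^sub>v y) $ j = (\<Sum>i<3. G $$ (i, j) * y $ i)"
      using j y carrier_matD[OF G_carrier] by (simp add: scalar_prod_def atLeast0LessThan)
    also have "{..<3 :: nat} = {0, Suc 0, 2}" by auto
    finally show "(G\<^sup>T *\<^sub>v y) $ j = codeword (y $ 0) (y $ 1) (y $ 2) $ j"
      using j by (simp add: G_index form_def mult.commute add.assoc)
  qed (simp add: carrier_matD[OF G_carrier])
  have "codeword a b c \<in> (*\<^sub>v) G\<^sup>T ` carrier_vec 3" for a b c
    by (rule image_eqI[of _ _ "vec 3 (\<lambda>i. [a, b, c] ! i)"]) (simp_all add: eq)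
  then show ?thesis
    unfolding code_of_eq_range[OF G_carrier] using eq by auto
qed

lemma dual_iff:
  "x \<in> dual_code (q + 5) (code_of G) \<longleftrightarrow> x \<in> carrier_vec (q + 5) \<and>
     (\<Sum>j<q+5. X j * x $ j) = 0 \<and> (\<Sum>j<q+5. Y j * x $ j) = 0 \<and> (\<Sum>j<q+5. Z j * x $ j) = 0"
proof -
  have "vec 3 (\<lambda>i. [a, b, c] ! i) = 0\<^sub>v 3 \<longleftrightarrow> a = 0 \<and> b = 0 \<and> c = 0" for a b c :: 'a
    by (auto simp: vec_eq_iff less_Suc_eq numeral_3_eq_3)
  then show ?thesis
    unfolding dual_code_of_eq_kernel[OF G_carrier] mat_kernel[OF G_carrier]
    by (auto simp: G_mult_vec)
qed

section \<open>Lines and the columns they contain\<close>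

text \<open>The bound counts the points of the hyperoval on the line \<open>a x + b y + c z = 0\<close>; the
  summands \<open>of_bool\<close> account for \<open>(1, 0, 0)\<close> and \<open>(0, 1, 0)\<close>.\<close>

lemma card_affine_zeros:
  assumes "a \<noteq> 0 \<or> b \<noteq> 0 \<or> c \<noteq> 0"
  shows "card {x. a * poly f x + b * x + c = 0} + of_bool (a = 0) + of_bool (b = 0) \<le> 2"
    (is "card ?S + _ + _ \<le> 2")
proof -
  have le1: "card S \<le> 1" if "\<And>x y. x \<in> S \<Longrightarrow> y \<in> S \<Longrightarrow> x = y" for S :: "'a set"
    using that by (auto simp: card_le_Suc0_iff_eq)
  consider "a = 0" "b = 0" | "a = 0" "b \<noteq> 0" | "a \<noteq> 0" "b = 0" | "a \<noteq> 0" "b \<noteq> 0" by blast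
  then show ?thesis
  proof cases
    case 1
    then show ?thesis using assms by simp
  next
    case 2
    then have "card ?S \<le> 1" by (intro le1) auto
    then show ?thesis using 2 by simp
  next
    case 3
    then have "card ?S \<le> 1" using f_inj by (intro le1) (auto simp: inj_eq)
    then show ?thesis using 3 by simp
  next
    case 4
    have "card ?S \<le> 2"
    proof (cases "?S = {}")
      case False
      then obtain x where x: "x \<in> ?S" by blast
      \<comment> \<open>Seen from \<open>x\<close>, all other points of the line have the same
        slope, so \<open>slope_inj\<close> leaves at most one of them.\<close>
      have slope: "(poly f x + poly f y) / (x + y) = b / a" if "y \<in> ?S - {x}" for y
      proof -
        have "a * poly f x + b * x + c = a * poly f y + b * y + c"
          using x that by simp
        from line_difference[OF this] have "a * (poly f x + poly f y) = b * (x + y)"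
          by (simp add: diff_eq add.commute)
        moreover have "x + y \<noteq> 0" using that by auto
        ultimately show ?thesis using 4 by (simp add: field_simps)
      qed
      have "card (?S - {x}) \<le> 1"
      proof (rule le1)
        fix y z assume yz: "y \<in> ?S - {x}" "z \<in> ?S - {x}"
        show "y = z"
        proof (rule slope_inj)
          show "y \<noteq> x" "z \<noteq> x" using yz by auto
          show "(poly f x + poly f y) / (x + y) = (poly f x + poly f z) / (x + z)"
            unfolding slope[OF yz(1)] slope[OF yz(2)] ..
        qed
      qed
      then show ?thesis using x by (simp add: card_Diff_singleton)
    qed simp
    then show ?thesis using 4 by simp
  qed
qed

lemma \<alpha>_Suc_inj: "i < q \<Longrightarrow> j < q \<Longrightarrow> \<alpha> (Suc i) = \<alpha> (Suc j) \<longleftrightarrow> i = j"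
  using \<alpha>_bij by (auto simp: bij_betw_def inj_on_eq_iff)

lemma \<alpha>_Suc_surj:
  obtains j where "j < q" "\<alpha> (Suc j) = x"
proof -
  have "x \<in> \<alpha> ` {1..q}" using \<alpha>_bij by (simp add: bij_betw_def)
  then obtain i where "i \<in> {1..q}" "\<alpha> i = x" by blast
  then show thesis by (intro that[of "i - 1"]) auto
qed

lemma \<alpha>_Suc_eq_0: "j < q \<Longrightarrow> \<alpha> (Suc j) = 0 \<longleftrightarrow> j = q - 1"
  using \<alpha>_Suc_inj[of j "q - 1"] \<alpha>_q q_ge_2 by simp

lemma columns_affine:
  "j < q \<Longrightarrow> X j = poly f (\<alpha> (Suc j))" "j < q \<Longrightarrow> Y j = \<alpha> (Suc j)" "j < q \<Longrightarrow> Z j = 1"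
  by (simp_all add: column_defs)

lemma columns_special:
  "X q = 1" "X (q + 1) = 0" "X (q + 2) = 1" "X (q + 3) = 0" "X (q + 4) = v"
  "Y q = 0" "Y (q + 1) = 1" "Y (q + 2) = 1" "Y (q + 3) = v" "Y (q + 4) = 0"
  "Z q = 0" "Z (q + 1) = 0" "Z (q + 2) = 0" "Z (q + 3) = 1" "Z (q + 4) = 1"
  by (simp_all add: column_defs)

text \<open>The simplified copies match simp normal form, in which \<open>q + 1\<close> reads
  \<open>Suc q\<close>.\<close>

lemmas columns = columns_affine columns_special columns_special[simplified]

lemma off_line: "poly f x + x + v \<noteq> 0"
  using v_not[of x] by (metis add_eq_0)

text \<open>The case split singles out the line x + y = v z. Any other line meets the hyperoval
  (\<open>A\<close> and \<open>B\<close>) at most twice and the last three columns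
  (\<open>D\<close>) at most once.\<close>

lemma card_form_zeros:
  assumes "a \<noteq> 0 \<or> b \<noteq> 0 \<or> c \<noteq> 0"
  shows "card {j. j < q + 5 \<and> form a b c j = 0} \<le> 3"
proof (cases "a = b \<and> c = a * v")
  case True
  then have a: "a \<noteq> 0" "b = a" "c = a * v" using assms by auto
  have nonzero: "form a b c j \<noteq> 0" if "j < q + 2" for j
  proof -
    have "form a b c j = a * (X j + Y j + v * Z j)"
      by (simp add: form_def a algebra_simps)
    moreover consider "j < q" | "j = q" | "j = q + 1" using \<open>j < q + 2\<close> by linarith
    then have "X j + Y j + v * Z j \<noteq> 0"
      by cases (use off_line in \<open>simp_all add: columns del: add_eq_0\<close>)
    ultimately show ?thesis using a by simp
  qed
  have "{j. j < q + 5 \<and> form a b c j = 0} \<subseteq> {q + 2..<q + 5}"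
  proof
    fix j assume j: "j \<in> {j. j < q + 5 \<and> form a b c j = 0}"
    then have "\<not> j < q + 2" using nonzero[of j] by blast
    with j show "j \<in> {q + 2..<q + 5}" by simp
  qed
  from card_mono[OF _ this] show ?thesis by simp
next
  case False
  define A where "A = {j. j < q \<and> form a b c j = 0}"
  define B where "B = {j \<in> {q, q + 1}. form a b c j = 0}"
  define D where "D = {j \<in> {q + 2, q + 3, q + 4}. form a b c j = 0}"
  have "card A = card ((\<alpha> \<circ> Suc) ` A)"
    by (rule card_image[symmetric]) (auto simp: inj_on_def A_def \<alpha>_Suc_inj)
  also have "\<dots> \<le> card {x. a * poly f x + b * x + c = 0}"
    by (rule card_mono) (auto simp: A_def form_def columns)
  finally have A: "card A \<le> card {x. a * poly f x + b * x + c = 0}" .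
  have "B = (if a = 0 then {q} else {}) \<union> (if b = 0 then {q + 1} else {})"
    by (auto simp: B_def form_def columns)
  then have B: "card B \<le> of_bool (a = 0) + of_bool (b = 0)"
    by simp
  \<comment> \<open>Zeros at the last three columns mean a = b, c = b v and c = a v respectively;
    any two of these give the excluded case, as v is nonzero.\<close>
  have D: "card D \<le> 1"
    using False unfolding D_def
    by (auto simp: card_le_Suc0_iff_eq form_def columns mult.commute)
  have zeros: "{j. j < q + 5 \<and> form a b c j = 0} = A \<union> B \<union> D"
    by (auto simp: A_def B_def D_def elim: index_cases)
  show ?thesis
    unfolding zeros using card_affine_zeros[OF assms] A B D card_Un_le[of A B] card_Un_le[of "A \<union> B" D]
    by linarith
qed

text \<open>Since \<open>f\<close> vanishes only at 0 and \<open>\<alpha> q = 0\<close>, the one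
  affine column on this line is column \<open>q - 1\<close>, the point (0, 0, 1).\<close>

lemma form_1_0_0_eq_0:
  assumes "j < q + 5"
  shows "form 1 0 0 j = 0 \<longleftrightarrow> j \<in> {q - 1, q + 1, q + 3}"
  using assms q_ge_2 by (cases rule: index_cases) (auto simp: form_def columns \<alpha>_Suc_eq_0)

lemma form_0_0_1_eq_0:
  assumes "j < q + 5"
  shows "form 0 0 1 j = 0 \<longleftrightarrow> j \<in> {q, q + 1, q + 2}"
  using assms by (cases rule: index_cases) (auto simp: form_def columns)

lemma form_1_1_v_eq_0:
  assumes "j < q + 5"
  shows "form 1 1 v j = 0 \<longleftrightarrow> j \<in> {q + 2, q + 3, q + 4}"
  using assms off_line
  by (cases rule: index_cases) (simp_all add: form_def columns del: add_eq_0)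

lemma hamming_weight_codeword:
  "hamming_weight (codeword a b c) + card {j. j < q + 5 \<and> form a b c j = 0} = q + 5"
proof -
  have "{j. j < dim_vec (codeword a b c) \<and> codeword a b c $ j = 0}
    = {j. j < q + 5 \<and> form a b c j = 0}" by auto
  then show ?thesis
    using hamming_weight_add_card_zeros[of "codeword a b c"] by simp
qed

lemma hamming_weight_codeword_eq:
  assumes "\<And>j. j < q + 5 \<Longrightarrow> form a b c j = 0 \<longleftrightarrow> j \<in> S" "S \<subseteq> {..<q + 5}" "card S = 3"
  shows "hamming_weight (codeword a b c) = q + 2"
proof -
  have "{j. j < q + 5 \<and> form a b c j = 0} = S" using assms(1,2) by auto
  then show ?thesis using hamming_weight_codeword[of a b c] assms(3) by simp
qed

lemma hamming_weight_special:
  "hamming_weight (codeword 1 0 0) = q + 2"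
  "hamming_weight (codeword 0 0 1) = q + 2"
  "hamming_weight (codeword 1 1 v) = q + 2"
proof -
  have "q - 1 \<noteq> q + 1" "q - 1 \<noteq> q + 3" using q_ge_2 by auto
  then show "hamming_weight (codeword 1 0 0) = q + 2"
    by (intro hamming_weight_codeword_eq[OF form_1_0_0_eq_0]) auto
  show "hamming_weight (codeword 0 0 1) = q + 2" "hamming_weight (codeword 1 1 v) = q + 2"
    by (intro hamming_weight_codeword_eq[OF form_0_0_1_eq_0]
        hamming_weight_codeword_eq[OF form_1_1_v_eq_0]; simp)+
qed

section \<open>Parameters of the code and of its dual\<close>

text \<open>Records a linear dependency between three columns; the indices are meant to be distinct,
  as the first match wins.\<close>

definition word3 :: "nat \<Rightarrow> nat \<Rightarrow> nat \<Rightarrow> 'a \<Rightarrow> 'a \<Rightarrow> 'a \<Rightarrow> 'a vec" where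
  "word3 i j k a b c =
     vec (q + 5) (\<lambda>l. if l = i then a else if l = j then b else if l = k then c else 0)"

lemma sum_word3:
  assumes "i < q + 5" "j < q + 5" "k < q + 5" "i \<noteq> j" "i \<noteq> k" "j \<noteq> k"
  shows "(\<Sum>l<q+5. h l * word3 i j k a b c $ l) = h i * a + h j * b + h k * c"
proof -
  have "(\<Sum>l<q+5. h l * word3 i j k a b c $ l) = (\<Sum>l\<in>{i, j, k}. h l * word3 i j k a b c $ l)"
    using assms by (intro sum.mono_neutral_right) (auto simp: word3_def)
  then show ?thesis using assms by (simp add: word3_def add.assoc)
qed

lemma surj_G: "(*\<^sub>v) G ` carrier_vec (q + 5) = carrier_vec 3"
proof -
  have "y \<in> (*\<^sub>v) G ` carrier_vec (q + 5)" if y: "y \<in> carrier_vec 3" for y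
  proof (rule image_eqI)
    \<comment> \<open>Columns \<open>q\<close>, \<open>q + 1\<close> and \<open>q - 1\<close> are
      the three unit vectors.\<close>
    let ?x = "word3 q (q + 1) (q - 1) (y $ 0) (y $ 1) (y $ 2)"
    show x: "?x \<in> carrier_vec (q + 5)" by (simp add: word3_def)
    have "X (q - 1) = 0" "Y (q - 1) = 0" "Z (q - 1) = 1" "q \<noteq> q - 1" "q + 1 \<noteq> q - 1"
      using q_ge_2 by (simp_all add: columns \<alpha>_q)
    then have "G *\<^sub>v ?x = vec 3 (\<lambda>i. [y $ 0, y $ 1, y $ 2] ! i)"
      unfolding G_mult_vec[OF x] by (simp add: sum_word3 columns)
    also have "\<dots> = y"
    proof (rule eq_vecI)
      fix i assume "i < dim_vec y"
      then have "i < 3" using y by simp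
      then show "vec 3 (\<lambda>i. [y $ 0, y $ 1, y $ 2] ! i) $ i = y $ i"
        by (cases rule: less_3_cases) simp_all
    qed (use y in simp)
    finally show "y = G *\<^sub>v ?x" by (rule sym)
  qed
  moreover have "G *\<^sub>v x \<in> carrier_vec 3" for x
    by (rule carrier_vecI) (simp add: carrier_matD[OF G_carrier])
  ultimately show ?thesis by blast
qed

text \<open>Distinct columns are distinct projective points; this rules out dual words of weight at
  most two.\<close>

lemma form_separates:
  assumes "i < q + 5" "j < q + 5" "i \<noteq> j"
  obtains a b c where "form a b c i \<noteq> 0" "form a b c j = 0"
proof (rule ccontr)
  assume "\<not> thesis"
  then have *: "form a b c i = 0" if "form a b c j = 0" for a b c
    using that \<open>\<And>a b c. form a b c i \<noteq> 0 \<Longrightarrow> form a b c j = 0 \<Longrightarrow> thesis\<close> by blast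
  \<comment> \<open>The three forms tried vanish at column \<open>j\<close> because x + x = 0. If
    they also vanish at column \<open>i\<close>, all 2 by 2 minors of the two columns are
    zero.\<close>
  have "Z j * Y i = Y j * Z i" "Z j * X i = X j * Z i" "Y j * X i = X j * Y i"
    using *[of 0 "Z j" "Y j"] *[of "Z j" 0 "X j"] *[of "Y j" "X j" 0]
    by (simp_all add: form_def mult.commute)
  with \<open>i \<noteq> j\<close> show False
    unfolding column_defs
    by (cases rule: index_cases[OF assms(1)]; cases rule: index_cases[OF assms(2)])
      (auto simp: \<alpha>_Suc_inj)
qed

lemma hamming_weight_word3:
  assumes "i < q + 5" "j < q + 5" "k < q + 5" "i \<noteq> j" "i \<noteq> k" "j \<noteq> k"
    and "a \<noteq> 0" "b \<noteq> 0" "c \<noteq> 0"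
  shows "hamming_weight (word3 i j k a b c) = 3"
proof -
  have "{l. l < dim_vec (word3 i j k a b c) \<and> word3 i j k a b c $ l \<noteq> 0} = {i, j, k}"
    using assms by (auto simp: word3_def split: if_splits)
  then show ?thesis using assms by (simp add: hamming_weight_def)
qed

lemma linear_code_G: "linear_code (q + 5) 3 (q + 2) (code_of G)"
  unfolding linear_code_def
proof (intro conjI ballI impI)
  show "\<exists>c\<in>code_of G. c \<noteq> 0\<^sub>v (q + 5) \<and> hamming_weight c = q + 2"
  proof (intro bexI conjI notI)
    show "codeword 0 0 1 \<in> code_of G" by (auto simp: code_of_G)
    assume "codeword 0 0 1 = 0\<^sub>v (q + 5)"
    then show False
      using hamming_weight_special(2) by (simp add: hamming_weight_def cong: conj_cong)
  qed (rule hamming_weight_special)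
  fix w assume "w \<in> code_of G" "w \<noteq> 0\<^sub>v (q + 5)"
  then obtain a b c where w: "w = codeword a b c" "a \<noteq> 0 \<or> b \<noteq> 0 \<or> c \<noteq> 0"
    by (fastforce simp: code_of_G form_def)
  then show "q + 2 \<le> hamming_weight w"
    using hamming_weight_codeword[of a b c] card_form_zeros[of a b c] by simp
qed (rule code_of_subspace_dim[OF G_carrier surj_G])+

lemma word3_in_dual:
  assumes "i < q + 5" "j < q + 5" "k < q + 5" "i \<noteq> j" "i \<noteq> k" "j \<noteq> k"
    and "X i * a + X j * b + X k * c = 0" "Y i * a + Y j * b + Y k * c = 0"
      "Z i * a + Z j * b + Z k * c = 0"
  shows "word3 i j k a b c \<in> dual_code (q + 5) (code_of G)"
  unfolding dual_iff using assms by (simp add: sum_word3 del: add_eq_0) (simp add: word3_def)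

text \<open>If the support lies in two columns, a form vanishing at just one of them reduces the
  inner product to a single nonzero term.\<close>

lemma dual_weight_ge_3:
  assumes x: "x \<in> dual_code (q + 5) (code_of G)" and nz: "x \<noteq> 0\<^sub>v (q + 5)"
  shows "3 \<le> hamming_weight x"
proof (rule ccontr)
  define S where "S = {j. j < dim_vec x \<and> x $ j \<noteq> 0}"
  assume "\<not> 3 \<le> hamming_weight x"
  then have S: "card S \<le> 2" by (simp add: S_def hamming_weight_def)
  have dim: "x \<in> carrier_vec (q + 5)" using x dual_iff by blast
  from nz obtain i where i: "i \<in> S"
    using dim by (fastforce simp: S_def vec_eq_iff)
  have "card (S - {i}) \<le> 1" using S i by (simp add: card_Diff_singleton)
  moreover have "finite S" by (simp add: S_def)
  ultimately have "\<exists>j. S - {i} \<subseteq> {j}" 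
    by (metis card_le_Suc0_iff_eq finite_Diff One_nat_def insertCI subsetI singletonI)
  then obtain j' where j': "S \<subseteq> {i, j'}" by blast
  \<comment> \<open>For weight one, \<open>j'\<close> may equal \<open>i\<close> or be out of range;
    any other valid index then serves.\<close>
  define j where "j = (if j' < q + 5 \<and> j' \<noteq> i then j' else if i = 0 then 1 else 0)"
  have j: "S \<subseteq> {i, j}" "j < q + 5" "i \<noteq> j"
    using j' dim by (auto simp: j_def S_def)
  have "i < q + 5" using i dim by (simp add: S_def)
  then obtain a b c where abc: "form a b c i \<noteq> 0" "form a b c j = 0"
    using form_separates j by metis
  have "0 = codeword a b c \<bullet> x"
    using x unfolding dual_code_def code_of_G by auto
  also have "\<dots> = (\<Sum>l<q+5. form a b c l * x $ l)"
    using dim by (simp add: scalar_prod_def atLeast0LessThan)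
  also have "\<dots> = (\<Sum>l\<in>{i}. form a b c l * x $ l)"
    using j abc dim \<open>i < q + 5\<close> by (intro sum.mono_neutral_right) (auto simp: S_def)
  finally show False using abc i by (simp add: S_def)
qed

text \<open>Supplies both a dual word of minimum weight and the repair sets of size two.\<close>

lemma index_in_dependent_triple:
  assumes "l < q + 5"
  shows "\<exists>y\<in>dual_code (q + 5) (code_of G). y $ l \<noteq> 0 \<and> hamming_weight y = 3"
proof -
  have *: ?thesis if "l \<in> {i, j, k}" "i < q + 5" "j < q + 5" "k < q + 5"
      "i \<noteq> j" "i \<noteq> k" "j \<noteq> k" "a \<noteq> 0" "b \<noteq> 0" "c \<noteq> 0"
      "X i * a + X j * b + X k * c = 0" "Y i * a + Y j * b + Y k * c = 0"
      "Z i * a + Z j * b + Z k * c = 0" for i j k a b c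
  proof (intro bexI conjI)
    show "word3 i j k a b c $ l \<noteq> 0" using that by (auto simp: word3_def)
    show "hamming_weight (word3 i j k a b c) = 3" using that by (intro hamming_weight_word3)
    show "word3 i j k a b c \<in> dual_code (q + 5) (code_of G)"
      using that by (intro word3_in_dual)
  qed
  consider "l < q" | "l \<in> {q, q + 1, q + 2}" | "l \<in> {q + 2, q + 3, q + 4}"
    using assms by (auto elim: index_cases)
  then show ?thesis
  proof cases
    case 1
    obtain y where y: "y \<noteq> \<alpha> (Suc l)" "poly f (\<alpha> (Suc l)) + poly f y = \<alpha> (Suc l) + y"
      using slope_1_exists .
    obtain j where j: "j < q" "\<alpha> (Suc j) = y" using \<alpha>_Suc_surj .
    \<comment> \<open>By the choice of \<open>y\<close>, columns \<open>l\<close> and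
      \<open>j\<close> add up to x + y times (1, 1, 0), where x is \<open>\<alpha> (Suc l)\<close>;
      this factor is nonzero.\<close>
    show ?thesis
      by (rule *[of l j "q + 2" 1 1 "\<alpha> (Suc l) + y"]) (use 1 y j in \<open>auto simp: columns\<close>)
  next
    case 2
    then show ?thesis
      by (intro *[of q "q + 1" "q + 2" 1 1 1]) (auto simp: columns)
  next
    case 3
    then show ?thesis
      \<comment> \<open>The relation is v (1, 1, 0) + (0, v, 1) + (v, 0, 1) = 0.\<close>
      by (intro *[of "q + 2" "q + 3" "q + 4" v 1 1]) (auto simp: columns)
  qed
qed

lemma linear_code_dual: "linear_code (q + 5) (q + 2) 3 (dual_code (q + 5) (code_of G))"
  unfolding linear_code_def
proof (intro conjI ballI impI)
  obtain y where y: "y \<in> dual_code (q + 5) (code_of G)" "y $ 0 \<noteq> 0" "hamming_weight y = 3"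
    using index_in_dependent_triple[of 0] by auto
  then show "\<exists>y\<in>dual_code (q + 5) (code_of G). y \<noteq> 0\<^sub>v (q + 5) \<and> hamming_weight y = 3"
    by (intro bexI[of _ y]) auto
  show "vectorspace.dim class_ring ((module_vec TYPE('a) (q + 5))
      \<lparr>carrier := dual_code (q + 5) (code_of G)\<rparr>) = q + 2"
    using dual_code_of_subspace_dim(2)[OF G_carrier surj_G] by simp
qed (use dual_code_of_subspace_dim(1)[OF G_carrier surj_G] dual_weight_ge_3 in auto)

lemma nmds_G: "nmds (q + 5) (code_of G)"
  unfolding nmds_def
proof (intro conjI exI)
  show "linear_code (q + 5) 3 (q + 2) (code_of G)" by (rule linear_code_G)
  show "linear_code (q + 5) (q + 2) 3 (dual_code (q + 5) (code_of G))" by (rule linear_code_dual)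
qed (simp_all add: singleton_defect_def)

section \<open>Locality of the code and of its dual\<close>

lemma has_locality_G: "has_locality (q + 5) (code_of G) 2"
proof (rule has_locality_if_orthogonal)
  show carrier: "code_of G \<subseteq> carrier_vec (q + 5)" by (auto simp: code_of_G)
  fix i assume "i < q + 5"
  then obtain y where y: "y \<in> dual_code (q + 5) (code_of G)" "y $ i \<noteq> 0" "hamming_weight y = 3"
    using index_in_dependent_triple by blast
  then have "y \<in> carrier_vec (q + 5)" "\<And>c. c \<in> code_of G \<Longrightarrow> y \<bullet> c = 0"
    using carrier by (auto simp: dual_code_def comm_scalar_prod[of _ "q + 5"])
  with y show "\<exists>y\<in>carrier_vec (q + 5). y $ i \<noteq> 0 \<and> hamming_weight y \<le> 2 + 1 \<and>
      (\<forall>c\<in>code_of G. y \<bullet> c = 0)"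
    by auto
qed

lemma has_locality_dual: "has_locality (q + 5) (dual_code (q + 5) (code_of G)) (q + 1)"
proof (rule has_locality_if_orthogonal)
  show "dual_code (q + 5) (code_of G) \<subseteq> carrier_vec (q + 5)" by (auto simp: dual_code_def)
  fix i assume i: "i < q + 5"
  have *: "\<exists>y\<in>carrier_vec (q + 5). y $ i \<noteq> 0 \<and> hamming_weight y \<le> (q + 1) + 1 \<and>
      (\<forall>x\<in>dual_code (q + 5) (code_of G). y \<bullet> x = 0)"
    if "form a b c i \<noteq> 0" "hamming_weight (codeword a b c) = q + 2" for a b c
    using that i
    by (intro bexI[of _ "codeword a b c"]) (auto simp: dual_code_def code_of_G)
  show "\<exists>y\<in>carrier_vec (q + 5). y $ i \<noteq> 0 \<and> hamming_weight y \<le> (q + 1) + 1 \<and>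
      (\<forall>x\<in>dual_code (q + 5) (code_of G). y \<bullet> x = 0)"
  proof (cases "i \<in> {q + 2, q + 3, q + 4}")
    case False
    then show ?thesis using form_1_1_v_eq_0[OF i] hamming_weight_special(3) * by blast
  next
    case True
    \<comment> \<open>Column \<open>q + 2\<close> is off the line x = 0, and columns
      \<open>q + 3\<close> and \<open>q + 4\<close> are off the line z = 0.\<close>
    then consider "i \<notin> {q - 1, q + 1, q + 3}" | "i \<notin> {q, q + 1, q + 2}" by auto
    then show ?thesis
      using form_1_0_0_eq_0[OF i] form_0_0_1_eq_0[OF i] hamming_weight_special * by cases blast+
  qed
qed

end

theorem theorem4p4:
  fixes f :: "'a::{field,finite} poly" and v :: 'a and \<alpha> :: "nat \<Rightarrow> 'a" and m q :: nat
  assumes "m > 0" and "q = 2 ^ m" and "CARD('a) = q"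
    and "o_polynomial f"
    and "v \<notin> {poly f x + x | x. True}"
    and "bij_betw \<alpha> {1..q} UNIV" and "\<alpha> q = 0"
  shows "linear_code (q + 5) 3 (q + 2) (code_of (gen_matrix f \<alpha> v)) \<and>
         nmds (q + 5) (code_of (gen_matrix f \<alpha> v)) \<and>
         has_locality (q + 5) (code_of (gen_matrix f \<alpha> v)) 2 \<and>
         has_locality (q + 5) (dual_code (q + 5) (code_of (gen_matrix f \<alpha> v))) (q + 1)"
proof -
  interpret oval_code f v \<alpha> q
    using assms by unfold_locales auto
  show ?thesis
    using linear_code_G nmds_G has_locality_G has_locality_dual by blast
qed

end
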